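(* Let $(I_n)_{n\geq 2}$ be a sequence of functions $I_n:\Gamma^{\circ}_n\rightarrow\mathbb{R}$, and suppose that there exist a sequence $(\varepsilon_n)_{n\geq 1}$ of nonnegative real numbers and a real number $\alpha\neq 1$ such that \[ \left|I_n(p_1,\ldots,p_n)-I_{n-1}(p_1+p_2,p_3,\ldots,p_n)-(p_1+p_2)^{\alpha}I_2\left(\frac{p_1}{p_1+p_2},\frac{p_2}{p_1+p_2}\right)\right|\leq\varepsilon_{n-1} \] for all $n\geq 3$ and $(p_1,\ldots,p_n)\in\Gamma^{\circ}_n$, and \[ \left|I_3(p_1,p_2,p_3)-I_3(p_1,p_3,p_2)\right|\leq\varepsilon_1 \] for all $(p_1,p_2,p_3)\in\Gamma^{\circ}_3$. Then: (1) if $\alpha<0$, there exist $c,d\in\mathbb{R}$ such that \[ \left|I_n(p_1,\ldots,p_n)-\left[cH^{\alpha}_n(p_1,\ldots,p_n)+d(p_1^{\alpha}-1)\right]\right| \leq\sum_{k=2}^{n-1}\varepsilon_k+K(\alpha)(2\varepsilon_2+\varepsilon_1)\left(1+\sum_{k=2}^{n-1}\left(\sum_{i=1}^{k}p_i^{\alpha}\right)\right) \] for all $n\geq 2$ and $(p_1,\ldots,p_n)\in\Gamma^{\circ}_n$; (2) if $\alpha=0$, there exist a logarithmic function $l:]0,1[\rightarrow\mathbb{R}$ and $c\in\mathbb{R}$ such that \[ \left|I_n(p_1,\ldots,p_n)-\left[cH^{0}_n(p_1,\ldots,p_n)+l(p_1)\right]\right|\leq\sum_{k=2}^{n-1}\varepsilon_k+K(\alpha)(n-1)(2\varepsilon_2+\varepsilon_1)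 \] for all $n\geq 2$ and $(p_1,\ldots,p_n)\in\Gamma^{\circ}_n$; (3) if $\alpha>0$ (and $\alpha\ne 1$), there exist $c,d\in\mathbb{R}$ such that \[ \left|I_n(p_1,\ldots,p_n)-\left[cH^{\alpha}_n(p_1,\ldots,p_n)+d(p_1^{\alpha}-1)\right]\right|\leq\sum_{k=2}^{n-1}\varepsilon_k+(n-1)K(\alpha)(2\varepsilon_2+\varepsilon_1) \] for all $n\geq 2$ and $(p_1,\ldots,p_n)\in\Gamma^{\circ}_n$. Here the convention $\sum_{k=2}^{1}\varepsilon_k=\sum_{k=2}^{1}\left(\sum_{i=1}^{k}p_i^{\alpha}\right)=0$ is adopted.
   Context: $]0,1[$ denotes the open unit interval. For $n\geq 2$, $\Gamma^{\circ}_n=\{(p_1,\ldots,p_n)\in\mathbb{R}^n \mid p_i>0\ (i=1,\ldots,n),\ \sum_{i=1}^n p_i=1\}$. For $\alpha\neq 1$, the entropy of degree $\alpha$ is \[ H^{\alpha}_n(p_1,\ldots,p_n)=\left(2^{1-\alpha}-1\right)^{-1}\left(\sum_{i=1}^{n}p_i^{\alpha}-1\right)\quad ((p_1,\ldots,p_n)\in\Gamma^{\circ}_n). \] A function $l:]0,1[\rightarrow\mathbb{R}$ is called logarithmic if $l(xy)=l(x)+l(y)$ for all $x,y\in\,]0,1[$. The constant $K(\alpha)$ is \[ K(\alpha)=\begin{cases} \left|2^{1-\alpha}-1\right|^{-1}\left(8+6\cdot 2^{\alpha}+2^{-\alpha}\right), & \text{if } \alpha<0,\\ 63, & \text{if }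 \alpha=0,\\ \left|2^{1-\alpha}-1\right|^{-1}\left(3+12\cdot 2^{\alpha}+\dfrac{32\cdot 3^{\alpha+1}}{\left|2^{-\alpha}-1\right|}\right), & \text{if } \alpha>0,\ \alpha\neq 1. \end{cases} \] *)

theory Defs
  imports Complex_Main
begin

text \<open>
  Points of \<open>\<real>\<^sup>n\<close> are lists of length \<open>n\<close>, so the coordinate \<open>p\<^sub>i\<close> is \<open>p ! (i - 1)\<close>.
  A sequence of functions \<open>I\<^sub>n\<close> on the open simplices is a function
  \<open>I :: nat \<Rightarrow> real list \<Rightarrow> real\<close> whose values \<open>I n p\<close> matter only for \<open>p\<close> in the \<open>n\<close>-th simplex.
  Likewise a function on the open unit interval is a total real function of which
  only the values on \<open>{0<..<1}\<close> matter.
\<close>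

definition open_simplex :: "nat \<Rightarrow> real list set" where
  "open_simplex n = {p. length p = n \<and> (\<forall>i<n. 0 < p ! i) \<and> (\<Sum>i<n. p ! i) = 1}"

definition entropy_deg :: "real \<Rightarrow> nat \<Rightarrow> real list \<Rightarrow> real" where
  "entropy_deg \<alpha> n p = inverse (2 powr (1 - \<alpha>) - 1) * ((\<Sum>i<n. (p ! i) powr \<alpha>) - 1)"

definition logarithmic :: "(real \<Rightarrow> real) \<Rightarrow> bool" where
  "logarithmic l \<longleftrightarrow> (\<forall>x\<in>{0<..<1}. \<forall>y\<in>{0<..<1}. l (x * y) = l x + l y)"

text \<open>The value at \<open>\<alpha> = 1\<close> is meaningless (it involves \<open>inverse 0\<close>) and never used.\<close>

definition K_const :: "real \<Rightarrow> real" where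
  "K_const \<alpha> =
     (if \<alpha> < 0 then
        inverse \<bar>2 powr (1 - \<alpha>) - 1\<bar> * (8 + 6 * 2 powr \<alpha> + 2 powr (- \<alpha>))
      else if \<alpha> = 0 then 63
      else
        inverse \<bar>2 powr (1 - \<alpha>) - 1\<bar> *
          (3 + 12 * 2 powr \<alpha> + 32 * 3 powr (\<alpha> + 1) / \<bar>2 powr (- \<alpha>) - 1\<bar>))"

end

theory Submission
  imports Defs
begin

text \<open>
  Put \<open>f x = I\<^sub>2(1 - x, x)\<close> and extend it to the homogeneous function
  \<open>G u v = (u + v)\<^sup>\<alpha> f (v / (u + v))\<close> of degree \<open>\<alpha>\<close>. Recursivity and semisymmetry for \<open>n = 3\<close> say that
  \<open>G (u + y) z + G u y\<close> is symmetric in \<open>y, z\<close> up to \<open>(2\<epsilon>\<^sub>2 + \<epsilon>\<^sub>1) (u + y + z)\<^sup>\<alpha>\<close>. Consequently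
  \<open>\<phi> u x y = G u x + G (u + x) y - G u (x + y)\<close> hardly depends on \<open>u\<close> and is an approximately symmetric
  cocycle in \<open>x, y\<close>. If \<open>\<alpha> < 0\<close>, the errors vanish as \<open>u\<close> tends to infinity, so that the equation holds
  exactly. Splitting \<open>x, y\<close> into the four atoms \<open>x, x, y, y\<close> and regrouping gives
  \<open>\<phi> u x y \<approx> a (x\<^sup>\<alpha> + y\<^sup>\<alpha> - (x + y)\<^sup>\<alpha>)\<close>. Hence \<open>\<rho> t = G t (1 - t) - a (1 - t)\<^sup>\<alpha>\<close> satisfies
  \<open>\<rho> (t s) \<approx> \<rho> t + t\<^sup>\<alpha> \<rho> s\<close>; exchanging \<open>t\<close> and \<open>s\<close> determines \<open>\<rho>\<close> if \<open>\<alpha> \<noteq> 0\<close>, and Hyers' theorem does if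
  \<open>\<alpha> = 0\<close>. The case of general \<open>n\<close> follows by recursivity.
\<close>

section \<open>Approximate cocycle equation for a homogeneous function of degree
  \<open>\<alpha>\<close>\<close>

text \<open>The error \<open>e\<close> is a parameter because for negative degree the same
  \<open>G\<close> is interpreted a second time with error 0.\<close>

locale approx_information =
  fixes G :: "real \<Rightarrow> real \<Rightarrow> real" and \<alpha> e :: real
  assumes e_nonneg: "0 \<le> e"
    and homogeneous: "\<lbrakk>0 < t; 0 < u; 0 < v\<rbrakk> \<Longrightarrow> G (t * u) (t * v) = t powr \<alpha> * G u v"
    and defect: "\<lbrakk>0 < u; 0 < y; 0 < z\<rbrakk> \<Longrightarrow>
      \<bar>G (u + y) z + G u y - G (u + z) y - G u z\<bar> \<le> e * (u + y + z) powr \<alpha>"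
begin

text \<open>Compares adjoining \<open>x\<close> and then \<open>y\<close> to the mass
  \<open>u\<close> with adjoining \<open>x + y\<close> at once. The expression bounded in
  \<open>defect\<close> is \<open>\<phi> u y z - \<phi> u z y\<close>.\<close>

definition \<phi> :: "real \<Rightarrow> real \<Rightarrow> real \<Rightarrow> real" where
  "\<phi> u x y = G u x + G (u + x) y - G u (x + y)"

lemma phi_homogeneous:
  assumes "0 < t" "0 < u" "0 < x" "0 < y"
  shows "\<phi> (t * u) (t * x) (t * y) = t powr \<alpha> * \<phi> u x y"
  using homogeneous[of t u x] homogeneous[of t "u + x" y] homogeneous[of t u "x + y"] assms
  by (simp add: \<phi>_def algebra_simps)

text \<open>The difference is, up to sign, the defect at \<open>(u, q, x)\<close> plus that at
  \<open>(u + x, q, y)\<close> minus that at \<open>(u, q, x + y)\<close>: all values of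
  \<open>G\<close> with second argument \<open>q\<close> cancel.\<close>

lemma phi_shift:
  assumes "0 < u" "0 < q" "0 < x" "0 < y"
  shows "\<bar>\<phi> u x y - \<phi> (u + q) x y\<bar>
    \<le> e * (u + q + x) powr \<alpha> + 2 * (e * (u + q + x + y) powr \<alpha>)"
  using defect[of u q x] defect[of "u + x" q y] defect[of u q "x + y"] assms
  by (simp add: \<phi>_def add.assoc add.commute add.left_commute)

text \<open>The defect is the antisymmetric part of \<open>\<phi>\<close> in its last two arguments.
  Moving the base from \<open>u\<close> to \<open>u + q\<close> costs a multiple of
  \<open>e * q powr \<alpha>\<close>, which tends to 0 as \<open>q\<close> grows.\<close>

lemma exact_if_neg:
  assumes "\<alpha> < 0"
  shows "approx_information G \<alpha> 0"
proof
  fix u y z :: real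
  assume pos: "0 < u" "0 < y" "0 < z"
  have less: "e * r powr \<alpha> \<le> e * q powr \<alpha>" if "0 < q" "q \<le> r" for q r
    using that assms e_nonneg by (intro mult_left_mono powr_mono2') auto
  \<comment> \<open>Two shifts of the base cost three defects each and one defect is left at
    \<open>u + q\<close>; each of these seven has total mass at least \<open>q\<close>.\<close>
  have "\<bar>G (u + y) z + G u y - G (u + z) y - G u z\<bar> \<le> 7 * (e * q powr \<alpha>)" if "0 < q" for q
  proof -
    have "G (u + y) z + G u y - G (u + z) y - G u z = \<phi> u y z - \<phi> u z y"
      by (simp add: \<phi>_def add.commute)
    moreover have "\<bar>\<phi> (u + q) y z - \<phi> (u + q) z y\<bar> \<le> e * (u + q + y + z) powr \<alpha>"
      using defect[of "u + q" y z] pos that by (simp add: \<phi>_def add.commute)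
    ultimately show ?thesis
      using phi_shift[of u q y z] phi_shift[of u q z y] less[of q "u + q + y"]
        less[of q "u + q + z"] less[of q "u + q + y + z"] less[of q "u + q + z + y"] pos that
      by linarith
  qed
  then have "\<forall>\<^sub>F q in at_top. \<bar>G (u + y) z + G u y - G (u + z) y - G u z\<bar> \<le> 7 * (e * q powr \<alpha>)"
    by (rule eventually_mono[OF eventually_gt_at_top[of 0]])
  moreover have "((\<lambda>q. 7 * (e * q powr \<alpha>)) \<longlongrightarrow> 7 * (e * 0)) at_top"
    by (intro tendsto_intros tendsto_neg_powr assms filterlim_ident)
  ultimately have "\<bar>G (u + y) z + G u y - G (u + z) y - G u z\<bar> \<le> 7 * (e * 0)"
    by (intro tendsto_lowerbound) auto
  then show "\<bar>G (u + y) z + G u y - G (u + z) y - G u z\<bar> \<le> 0 * (u + y + z) powr \<alpha>" by simp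
qed (simp_all add: homogeneous)

text \<open>For \<open>\<alpha> \<ge> 0\<close> the power is monotone, so one bound \<open>r\<close>
  on the total masses serves all three errors of a shift. The alternative \<open>e = 0\<close>
  covers negative degree after \<open>exact_if_neg\<close>.\<close>

lemma phi_near:
  assumes "0 \<le> \<alpha> \<or> e = 0" and pos: "0 < u" "0 < v" "0 < x" "0 < y"
    and le: "u + x + y \<le> r" "v + x + y \<le> r"
  shows "\<bar>\<phi> u x y - \<phi> v x y\<bar> \<le> 3 * (e * r powr \<alpha>)"
proof -
  have mono: "e * s powr \<alpha> \<le> e * r powr \<alpha>" if "0 < s" "s \<le> r" for s
    using assms(1) that e_nonneg by (cases "e = 0") (simp_all add: mult_left_mono powr_mono2)
  have *: "\<bar>\<phi> u x y - \<phi> v x y\<bar> \<le> 3 * (e * r powr \<alpha>)"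
    if "0 < u" "u < v" "v + x + y \<le> r" for u v
    using phi_shift[of u "v - u" x y] mono[of "v + x"] mono[of "v + x + y"] that pos by simp
  consider "u < v" | "u = v" | "v < u" by linarith
  then show ?thesis
  proof cases
    case 2
    then show ?thesis using e_nonneg by simp
  qed (use *[of u v] *[of v u] assms in \<open>simp_all add: abs_minus_commute\<close>)
qed

text \<open>Adjoining the atoms in the order \<open>x, x, y, y\<close> or \<open>x, y, x, y\<close>
  gives two expansions that differ by one defect. Equal arguments yield multiples of
  \<open>\<phi> 1 1 1\<close>, doubled arguments yield
  \<open>2 powr \<alpha> * \<phi> u x y\<close>, and the result is solved for
  \<open>\<phi> u x y\<close>, whose coefficient \<open>2 - 2 powr \<alpha>\<close> is nonzero as
  \<open>\<alpha> \<noteq> 1\<close>.\<close>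

lemma phi_approx:
  assumes deg: "0 \<le> \<alpha> \<or> e = 0" and ne: "\<alpha> \<noteq> 1"
    and pos: "0 < u" "0 < x" "0 < y" and sum: "u + x + y = 1"
  shows "\<bar>\<phi> u x y - \<phi> 1 1 1 / (2 - 2 powr \<alpha>) * (x powr \<alpha> + y powr \<alpha> - (x + y) powr \<alpha>)\<bar>
    \<le> e * (7 * 2 powr \<alpha> + 9 * 3 powr \<alpha>) / \<bar>2 - 2 powr \<alpha>\<bar>"
proof -
  let ?c = "\<phi> 1 1 1"
  have c: "\<phi> t t t = t powr \<alpha> * ?c" if "0 < t" for t
    using phi_homogeneous[of t 1 1 1] that by simp
  have nz: "2 - 2 powr \<alpha> \<noteq> 0"
    using ne powr_inj[of 2 \<alpha> 1] by auto
  \<comment> \<open>Since \<open>u + x + y = 1\<close>, the total masses compared are at most 3 in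
    the first three estimates and at most 2 in the last three; hence the coefficients 3 + 3 + 3 = 9
    and 3 + 3 + 1 = 7.\<close>
  have 1: "\<bar>\<phi> u x x - x powr \<alpha> * ?c\<bar> \<le> 3 * (e * 3 powr \<alpha>)"
    using phi_near[OF deg, of u x x x 3] c[of x] pos sum by simp
  have 2: "\<bar>\<phi> (u + x + x) y y - y powr \<alpha> * ?c\<bar> \<le> 3 * (e * 3 powr \<alpha>)"
    using phi_near[OF deg, of "u + x + x" y y y 3] c[of y] pos sum by simp
  have 3: "\<bar>\<phi> u (x + y) (x + y) - (x + y) powr \<alpha> * ?c\<bar> \<le> 3 * (e * 3 powr \<alpha>)"
    using phi_near[OF deg, of u "x + y" "x + y" "x + y" 3] c[of "x + y"] pos sum by simp
  have 4: "\<bar>\<phi> u (x + x) (y + y) - 2 powr \<alpha> * \<phi> u x y\<bar> \<le> 3 * (e * 2 powr \<alpha>)"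
    using phi_near[OF deg, of u "2 * u" "x + x" "y + y" 2] phi_homogeneous[of 2 u x y] pos sum
    by simp
  have 5: "\<bar>\<phi> (u + x + y) x y - \<phi> u x y\<bar> \<le> 3 * (e * 2 powr \<alpha>)"
    using phi_near[OF deg, of "u + x + y" u x y 2] pos sum by simp
  have "e * (u + x + x + y) powr \<alpha> \<le> e * 2 powr \<alpha>"
    using deg pos sum e_nonneg by (cases "e = 0") (simp_all add: mult_left_mono powr_mono2)
  then have 6: "\<bar>G (u + x + x) y + G (u + x) x - G (u + x + y) x - G (u + x) y\<bar> \<le> e * 2 powr \<alpha>"
    using defect[of "u + x" x y] pos by simp
  \<comment> \<open>Both groupings telescope to chains from \<open>u\<close> with the same first and
    last steps; only the exchange of the two middle atoms over the base \<open>u + x\<close>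
    survives.\<close>
  have "\<phi> u x x + \<phi> (u + x + x) y y + \<phi> u (x + x) (y + y)
      - \<phi> u x y - \<phi> (u + x + y) x y - \<phi> u (x + y) (x + y)
    = G (u + x + x) y + G (u + x) x - G (u + x + y) x - G (u + x) y"
    by (simp add: \<phi>_def add.assoc add.commute add.left_commute)
  then have "\<bar>2 * \<phi> u x y - 2 powr \<alpha> * \<phi> u x y
      - (x powr \<alpha> * ?c + y powr \<alpha> * ?c - (x + y) powr \<alpha> * ?c)\<bar>
    \<le> 7 * (e * 2 powr \<alpha>) + 9 * (e * 3 powr \<alpha>)"
    using 1 2 3 4 5 6 by linarith
  also have "2 * \<phi> u x y - 2 powr \<alpha> * \<phi> u x y
      - (x powr \<alpha> * ?c + y powr \<alpha> * ?c - (x + y) powr \<alpha> * ?c)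
    = (\<phi> u x y - ?c / (2 - 2 powr \<alpha>) * (x powr \<alpha> + y powr \<alpha> - (x + y) powr \<alpha>)) * (2 - 2 powr \<alpha>)"
    using nz by (simp add: field_simps)
  also have "7 * (e * 2 powr \<alpha>) + 9 * (e * 3 powr \<alpha>) = e * (7 * 2 powr \<alpha> + 9 * 3 powr \<alpha>)"
    by (simp add: algebra_simps)
  finally show ?thesis
    using nz by (simp add: abs_mult pos_le_divide_eq)
qed

text \<open>This is \<open>phi_approx\<close> for the partition of 1 into \<open>t * s\<close>,
  \<open>t - t * s\<close> and \<open>1 - t\<close>; homogeneity extracts
  \<open>t powr \<alpha>\<close> from the first two parts.\<close>

lemma power_approx_multiplicative:
  assumes "0 \<le> \<alpha> \<or> e = 0" "\<alpha> \<noteq> 1"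
  shows "\<exists>a. \<forall>s\<in>{0<..<1}. \<forall>t\<in>{0<..<1}.
    \<bar>(G (t * s) (1 - t * s) - a * (1 - t * s) powr \<alpha>)
      - (G t (1 - t) - a * (1 - t) powr \<alpha>)
      - t powr \<alpha> * (G s (1 - s) - a * (1 - s) powr \<alpha>)\<bar>
    \<le> e * (7 * 2 powr \<alpha> + 9 * 3 powr \<alpha>) / \<bar>2 - 2 powr \<alpha>\<bar>"
proof -
  define a where "a = \<phi> 1 1 1 / (2 - 2 powr \<alpha>)"
  show ?thesis
  proof (intro exI ballI)
    fix s t :: real
    assume "s \<in> {0<..<1}" "t \<in> {0<..<1}"
    then have st: "0 < s" "s < 1" "0 < t" "t < 1" by auto
    have "G (t * s) (t - t * s) = t powr \<alpha> * G s (1 - s)"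
      using homogeneous[of t s "1 - s"] st by (simp add: algebra_simps)
    moreover have "(t - t * s) powr \<alpha> = t powr \<alpha> * (1 - s) powr \<alpha>"
      using powr_mult[of t "1 - s" \<alpha>] st by (simp add: algebra_simps)
    ultimately have "(G (t * s) (1 - t * s) - a * (1 - t * s) powr \<alpha>)
        - (G t (1 - t) - a * (1 - t) powr \<alpha>)
        - t powr \<alpha> * (G s (1 - s) - a * (1 - s) powr \<alpha>)
      = - (\<phi> (t * s) (t - t * s) (1 - t)
          - a * ((t - t * s) powr \<alpha> + (1 - t) powr \<alpha> - (t - t * s + (1 - t)) powr \<alpha>))"
      by (simp add: \<phi>_def algebra_simps)
    moreover have "\<bar>\<phi> (t * s) (t - t * s) (1 - t)
          - a * ((t - t * s) powr \<alpha> + (1 - t) powr \<alpha> - (t - t * s + (1 - t)) powr \<alpha>)\<bar>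
        \<le> e * (7 * 2 powr \<alpha> + 9 * 3 powr \<alpha>) / \<bar>2 - 2 powr \<alpha>\<bar>"
      unfolding a_def using st by (intro phi_approx assms) auto
    ultimately show "\<bar>(G (t * s) (1 - t * s) - a * (1 - t * s) powr \<alpha>)
        - (G t (1 - t) - a * (1 - t) powr \<alpha>)
        - t powr \<alpha> * (G s (1 - s) - a * (1 - s) powr \<alpha>)\<bar>
      \<le> e * (7 * 2 powr \<alpha> + 9 * 3 powr \<alpha>) / \<bar>2 - 2 powr \<alpha>\<bar>"
      by (simp only: abs_minus_cancel)
  qed
qed

text \<open>The two ways of expanding \<open>\<rho> (t / 2)\<close>, with factors \<open>t\<close>
  and \<open>1 / 2\<close> in either order, give a linear equation for \<open>\<rho> t\<close> with
  coefficient \<open>2 powr (- \<alpha>) - 1\<close>, which is nonzero as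
  \<open>\<alpha> \<noteq> 0\<close>.\<close>

lemma power_stability:
  assumes "0 \<le> \<alpha> \<or> e = 0" "\<alpha> \<noteq> 1" "\<alpha> \<noteq> 0"
  shows "\<exists>a b. \<forall>t\<in>{0<..<1}.
    \<bar>G t (1 - t) - (a * (1 - t) powr \<alpha> + b * (t powr \<alpha> - 1))\<bar>
    \<le> 2 * (e * (7 * 2 powr \<alpha> + 9 * 3 powr \<alpha>) / \<bar>2 - 2 powr \<alpha>\<bar>) / \<bar>2 powr (- \<alpha>) - 1\<bar>"
proof -
  define M where "M = e * (7 * 2 powr \<alpha> + 9 * 3 powr \<alpha>) / \<bar>2 - 2 powr \<alpha>\<bar>"
  obtain a where a: "\<forall>s\<in>{0<..<1}. \<forall>t\<in>{0<..<1}.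
    \<bar>(G (t * s) (1 - t * s) - a * (1 - t * s) powr \<alpha>) - (G t (1 - t) - a * (1 - t) powr \<alpha>)
      - t powr \<alpha> * (G s (1 - s) - a * (1 - s) powr \<alpha>)\<bar> \<le> M"
    using power_approx_multiplicative[OF assms(1,2)] unfolding M_def by (elim exE)
  define \<rho> where "\<rho> t = G t (1 - t) - a * (1 - t) powr \<alpha>" for t
  define d where "d = 2 powr (- \<alpha>) - 1"
  have nz: "d \<noteq> 0"
    using assms(3) powr_inj[of 2 "- \<alpha>" 0] by (auto simp: d_def)
  have half: "(1 / 2) powr \<alpha> = d + 1"
    by (simp add: d_def powr_minus_divide powr_divide)
  have "\<bar>\<rho> t - \<rho> (1 / 2) / d * (t powr \<alpha> - 1)\<bar> \<le> 2 * M / \<bar>d\<bar>"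
    if t: "t \<in> {0<..<1}" for t
  proof -
    have "\<bar>\<rho> (t / 2) - \<rho> t - t powr \<alpha> * \<rho> (1 / 2)\<bar> \<le> M"
      using bspec[OF bspec[OF a, of "1 / 2"], of t] t by (simp add: \<rho>_def)
    moreover have "\<bar>\<rho> (t / 2) - \<rho> (1 / 2) - (d + 1) * \<rho> t\<bar> \<le> M"
      using bspec[OF bspec[OF a, of t], of "1 / 2"] t unfolding half by (simp add: \<rho>_def)
    ultimately have "\<bar>d * \<rho> t - \<rho> (1 / 2) * (t powr \<alpha> - 1)\<bar> \<le> 2 * M"
      by (simp add: algebra_simps)
    also have "d * \<rho> t - \<rho> (1 / 2) * (t powr \<alpha> - 1)
        = (\<rho> t - \<rho> (1 / 2) / d * (t powr \<alpha> - 1)) * d"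
      using nz by (simp add: field_simps)
    finally show ?thesis
      using nz by (simp add: abs_mult pos_le_divide_eq)
  qed
  then show ?thesis
    unfolding \<rho>_def M_def d_def diff_diff_eq by (intro exI ballI)
qed

end

section \<open>Hyers' stability theorem for logarithmic functions\<close>

text \<open>Hyers' method with squaring in place of doubling: the sequence
  \<open>\<rho> (t ^ 2 ^ n) / 2 ^ n\<close> moves by at most \<open>\<delta> / 2 ^ (n + 1)\<close>
  at each step, in total by \<open>\<delta>\<close>, and its defect from additivity is divided by
  \<open>2 ^ n\<close>.\<close>

lemma logarithmic_stability:
  fixes \<rho> :: "real \<Rightarrow> real"
  assumes approx: "\<And>s t. \<lbrakk>0 < s; s < 1; 0 < t; t < 1\<rbrakk> \<Longrightarrow> \<bar>\<rho> (t * s) - \<rho> t - \<rho> s\<bar> \<le> \<delta>"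
  shows "\<exists>l. logarithmic l \<and> (\<forall>t\<in>{0<..<1}. \<bar>\<rho> t - l t\<bar> \<le> \<delta>)"
proof -
  define A where "A t n = \<rho> (t ^ 2 ^ n) / 2 ^ n" for t and n :: nat
  have pw: "0 < t ^ 2 ^ n \<and> t ^ 2 ^ n < 1" if "0 < t" "t < 1" for t :: real and n :: nat
    using that by (simp add: power_less_one_iff)
  have step: "\<bar>A t (Suc n) - A t n\<bar> \<le> \<delta> * (1 / 2) ^ Suc n" if t: "0 < t" "t < 1" for t n
  proof -
    have "\<bar>\<rho> (t ^ 2 ^ n * t ^ 2 ^ n) - \<rho> (t ^ 2 ^ n) - \<rho> (t ^ 2 ^ n)\<bar> \<le> \<delta>"
      using pw[OF t, of n] by (intro approx) auto
    moreover have "t ^ 2 ^ Suc n = t ^ 2 ^ n * t ^ 2 ^ n"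
      by (simp add: mult_2 power_add)
    then have "A t (Suc n) - A t n
        = (\<rho> (t ^ 2 ^ n * t ^ 2 ^ n) - \<rho> (t ^ 2 ^ n) - \<rho> (t ^ 2 ^ n)) / 2 ^ Suc n"
      unfolding A_def by (simp add: diff_divide_distrib)
    ultimately have "\<bar>A t (Suc n) - A t n\<bar> \<le> \<delta> / 2 ^ Suc n"
      by (simp only: abs_divide) (simp add: divide_right_mono)
    then show ?thesis
      by (simp only: power_one_over times_divide_eq_right mult_1_right)
  qed
  have geo: "(\<lambda>n. \<delta> * (1 / 2) ^ Suc n) sums \<delta>"
    using sums_mult[OF power_half_series, of \<delta>] by simp
  \<comment> \<open>Written as a telescoping series, the limit has its distance from
    \<open>A t 0 = \<rho> t\<close> bounded by the sum of the step bounds.\<close>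
  define l where "l t = A t 0 + (\<Sum>n. A t (Suc n) - A t n)" for t
  have abs_summ: "summable (\<lambda>n. \<bar>A t (Suc n) - A t n\<bar>)" if t: "0 < t" "t < 1" for t
    by (rule summable_comparison_test'[OF sums_summable[OF geo], of 0])
      (simp only: real_norm_def abs_idempotent step[OF t])
  have lim: "A t \<longlonglongrightarrow> l t" if t: "0 < t" "t < 1" for t
  proof -
    have "(\<lambda>n. A t 0 + (\<Sum>i<n. A t (Suc i) - A t i)) \<longlonglongrightarrow> l t"
      unfolding l_def
      by (rule tendsto_add[OF tendsto_const summable_LIMSEQ[OF summable_rabs_cancel[OF abs_summ[OF t]]]])
    then show ?thesis by (simp add: sum_lessThan_telescope)
  qed
  have close: "\<bar>\<rho> t - l t\<bar> \<le> \<delta>" if t: "0 < t" "t < 1" for t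
  proof -
    have "\<bar>\<Sum>n. A t (Suc n) - A t n\<bar> \<le> (\<Sum>n. \<bar>A t (Suc n) - A t n\<bar>)"
      by (rule summable_rabs[OF abs_summ[OF t]])
    also have "\<dots> \<le> (\<Sum>n. \<delta> * (1 / 2) ^ Suc n)"
      by (rule suminf_le[OF step[OF t] abs_summ[OF t] sums_summable[OF geo]])
    also have "\<dots> = \<delta>" using geo by (rule sums_unique[symmetric])
    finally show ?thesis by (simp add: l_def A_def)
  qed
  have "l (x * y) = l x + l y" if x: "0 < x" "x < 1" and y: "0 < y" "y < 1" for x y
  proof -
    have xy: "0 < x * y" "x * y < 1"
      using x y mult_strict_mono[of x 1 y 1] by auto
    have "(\<lambda>n. (1 / 2 :: real) ^ n) \<longlonglongrightarrow> 0"
      by (rule LIMSEQ_power_zero) simp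
    moreover have "\<forall>\<^sub>F n in sequentially.
        norm (A (x * y) n - A x n - A y n) \<le> norm ((1 / 2 :: real) ^ n) * \<delta>"
    proof (intro always_eventually allI)
      fix n
      have "\<bar>\<rho> (x ^ 2 ^ n * y ^ 2 ^ n) - \<rho> (x ^ 2 ^ n) - \<rho> (y ^ 2 ^ n)\<bar> \<le> \<delta>"
        using pw[OF x, of n] pw[OF y, of n] by (intro approx) auto
      moreover have "A (x * y) n - A x n - A y n
          = (\<rho> (x ^ 2 ^ n * y ^ 2 ^ n) - \<rho> (x ^ 2 ^ n) - \<rho> (y ^ 2 ^ n)) / 2 ^ n"
        by (simp add: A_def diff_divide_distrib power_mult_distrib)
      ultimately show "norm (A (x * y) n - A x n - A y n) \<le> norm ((1 / 2 :: real) ^ n) * \<delta>"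
        by (simp add: power_one_over divide_right_mono)
    qed
    ultimately have "(\<lambda>n. A (x * y) n - A x n - A y n) \<longlonglongrightarrow> 0"
      by (rule tendsto_0_le)
    moreover have "(\<lambda>n. A (x * y) n - A x n - A y n) \<longlonglongrightarrow> l (x * y) - l x - l y"
      by (intro tendsto_intros lim x y xy)
    ultimately have "l (x * y) - l x - l y = 0"
      by (rule LIMSEQ_unique[rotated])
    then show ?thesis by simp
  qed
  then have "logarithmic l" by (simp add: logarithmic_def)
  then show ?thesis using close by auto
qed

section \<open>Passage from two probabilities to \<open>n\<close> by recursivity\<close>

lemma entropy_deg_binary:
  "entropy_deg \<alpha> 2 [x, y] = inverse (2 powr (1 - \<alpha>) - 1) * (x powr \<alpha> + y powr \<alpha> - 1)"
  by (simp add: entropy_deg_def numeral_2_eq_2)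

text \<open>The weight \<open>(x + y) powr \<alpha>\<close> cancels the denominators, so the entropy
  is recursive without error and adds nothing to the estimate in the induction.\<close>

lemma entropy_deg_recursive:
  assumes "0 < x" "0 < y"
  shows "entropy_deg \<alpha> (Suc (Suc m)) (x # y # ps) = entropy_deg \<alpha> (Suc m) ((x + y) # ps)
    + (x + y) powr \<alpha> * entropy_deg \<alpha> 2 [x / (x + y), y / (x + y)]"
proof -
  define c where "c = inverse (2 powr (1 - \<alpha>) - (1::real))"
  have "(x + y) powr \<alpha> * (x / (x + y)) powr \<alpha> = x powr \<alpha>"
    "(x + y) powr \<alpha> * (y / (x + y)) powr \<alpha> = y powr \<alpha>"
    using assms by (simp_all add: powr_divide)
  then have "(x + y) powr \<alpha> * (c * ((x / (x + y)) powr \<alpha> + (y / (x + y)) powr \<alpha> - 1))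
      = c * (x powr \<alpha> + y powr \<alpha> - (x + y) powr \<alpha>)"
    by (simp add: right_diff_distrib distrib_left mult.left_commute[of _ c])
  then show ?thesis
    unfolding entropy_deg_binary unfolding entropy_deg_def c_def[symmetric]
    by (simp add: sum.lessThan_Suc_shift algebra_simps del: sum.lessThan_Suc)
qed

lemma open_simplex_merge:
  assumes "x # y # ps \<in> open_simplex (Suc (Suc m))"
  shows "(x + y) # ps \<in> open_simplex (Suc m)"
  using assms unfolding open_simplex_def
  by (auto simp: sum.lessThan_Suc_shift All_less_Suc2
      simp del: sum.lessThan_Suc)

text \<open>By \<open>h\<close>, the approximating expression is exactly recursive. Each merge of
  the first two entries therefore costs one \<open>\<epsilon> k\<close> and \<open>B\<close> times
  the power of the merged mass; the merged masses are the partial sums of \<open>p\<close>.\<close>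

lemma recursive_error:
  fixes I :: "nat \<Rightarrow> real list \<Rightarrow> real"
  assumes recursivity: "\<And>n p1 p2 ps. n \<ge> 3 \<Longrightarrow> p1 # p2 # ps \<in> open_simplex n \<Longrightarrow>
      \<bar>I n (p1 # p2 # ps) - I (n - 1) ((p1 + p2) # ps)
        - (p1 + p2) powr \<alpha> * I 2 [p1 / (p1 + p2), p2 / (p1 + p2)]\<bar> \<le> \<epsilon> (n - 1)"
    and binary: "\<And>x. \<lbrakk>0 < x; x < 1\<rbrakk> \<Longrightarrow>
      \<bar>I 2 [x, 1 - x] - (c * entropy_deg \<alpha> 2 [x, 1 - x] + h x)\<bar> \<le> B"
    and h: "\<And>x s. \<lbrakk>0 < x; x < s; s < 1\<rbrakk> \<Longrightarrow> h x = h s + s powr \<alpha> * h (x / s)"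
    and "2 \<le> n" "p \<in> open_simplex n"
  shows "\<bar>I n p - (c * entropy_deg \<alpha> n p + h (p ! 0))\<bar>
    \<le> (\<Sum>k=2..n-1. \<epsilon> k) + B * (1 + (\<Sum>k=2..n-1. (\<Sum>i<k. p ! i) powr \<alpha>))"
  using assms(4,5)
proof (induction n arbitrary: p rule: dec_induct)
  case base
  then obtain x y where "p = [x, y]" "0 < x" "0 < y" "x + y = 1"
    by (auto simp: open_simplex_def numeral_2_eq_2 length_Suc_conv All_less_Suc2)
  then show ?case using binary[of x] by (simp add: eq_diff_eq[symmetric])
next
  case (step n)
  obtain m where m: "n = Suc m" "1 \<le> m"
    using step.hyps by (cases n) auto
  obtain x y ps where p: "p = x # y # ps"
    using step.prems m by (auto simp: open_simplex_def length_Suc_conv)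
  define s where "s = x + y"
  define psum where "psum r k = (\<Sum>i<k. r ! i)" for r :: "real list" and k
  have pos: "0 < p ! i" if "i < Suc n" for i
    using step.prems that by (simp add: open_simplex_def)
  have x: "0 < x" and y: "0 < y"
    using pos[of 0] pos[of 1] m p by auto
  then have s: "0 < s" "x < s"
    by (simp_all add: s_def)
  have q: "s # ps \<in> open_simplex n"
    using open_simplex_merge step.prems m p by (simp add: s_def)
  have psum_merge: "psum (s # ps) (Suc k) = psum p (Suc (Suc k))" for k
    by (simp add: psum_def p s_def sum.lessThan_Suc_shift del: sum.lessThan_Suc)
  have "1 = psum p (Suc n)"
    using step.prems by (simp add: open_simplex_def psum_def)
  also have "psum p (Suc n) = s + (\<Sum>i<m. p ! Suc (Suc i))"
    by (simp add: psum_def p s_def m sum.lessThan_Suc_shift del: sum.lessThan_Suc)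
  \<comment> \<open>As \<open>1 \<le> m\<close>, at least one positive coordinate remains besides
    the merged pair.\<close>
  also have "\<dots> > s"
    using m pos by (auto intro!: sum_pos simp: lessThan_empty_iff)
  finally have "s < 1" .
  then have h_x: "h x = h s + s powr \<alpha> * h (x / s)"
    using h x s by blast
  have ent: "entropy_deg \<alpha> (Suc n) p = entropy_deg \<alpha> n (s # ps)
      + s powr \<alpha> * entropy_deg \<alpha> 2 [x / s, y / s]"
    using entropy_deg_recursive[OF x y] by (simp add: p m s_def)
  have "y / s = 1 - x / s"
    using s by (simp add: s_def field_simps)
  then have "\<bar>I 2 [x / s, y / s] - (c * entropy_deg \<alpha> 2 [x / s, y / s] + h (x / s))\<bar> \<le> B"
    using binary[of "x / s"] x s by simp
  then have "s powr \<alpha> * \<bar>I 2 [x / s, y / s] - (c * entropy_deg \<alpha> 2 [x / s, y / s] + h (x / s))\<bar>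
      \<le> s powr \<alpha> * B"
    by (rule mult_left_mono) simp
  then have "\<bar>s powr \<alpha> * (I 2 [x / s, y / s] - (c * entropy_deg \<alpha> 2 [x / s, y / s] + h (x / s)))\<bar>
      \<le> s powr \<alpha> * B"
    by (simp add: abs_mult)
  moreover have "\<bar>I (Suc n) p - I n (s # ps) - s powr \<alpha> * I 2 [x / s, y / s]\<bar> \<le> \<epsilon> n"
    using recursivity[of "Suc n" x y ps] step.prems step.hyps p by (simp add: s_def)
  moreover have "\<bar>I n (s # ps) - (c * entropy_deg \<alpha> n (s # ps) + h s)\<bar>
      \<le> (\<Sum>k=2..n-1. \<epsilon> k) + B * (1 + (\<Sum>k=2..n-1. psum (s # ps) k powr \<alpha>))"
    using step.IH[OF q] by (simp add: psum_def)
  moreover have "(\<Sum>k=2..n. \<epsilon> k) = (\<Sum>k=2..n-1. \<epsilon> k) + \<epsilon> n"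
    using step.hyps m by simp
  \<comment> \<open>The term \<open>k = 2\<close> is the weight \<open>s powr \<alpha>\<close> of
    the present merge. The later ones are those of the merged list, whose partial sums are those of
    \<open>p\<close> with the index lowered by one.\<close>
  moreover have "B * (1 + (\<Sum>k=2..n. psum p k powr \<alpha>))
      = s powr \<alpha> * B + B * (1 + (\<Sum>k=2..n-1. psum (s # ps) k powr \<alpha>))"
  proof -
    have "(\<Sum>k=2..n-1. psum (s # ps) k powr \<alpha>) = (\<Sum>k=2..m. psum p (Suc k) powr \<alpha>)"
    proof (rule sum.cong)
      fix k assume "k \<in> {2..m}"
      then show "psum (s # ps) k powr \<alpha> = psum p (Suc k) powr \<alpha>"
        using psum_merge[of "k - 1"] by simp
    qed (simp add: m)
    also have "\<dots> = (\<Sum>k=Suc 2..n. psum p k powr \<alpha>)"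
      unfolding m by (rule sum.shift_bounds_cl_Suc_ivl[symmetric])
    finally show ?thesis
      using sum.atLeast_Suc_atMost[OF step.hyps(1), of "\<lambda>k. psum p k powr \<alpha>"]
      by (simp add: psum_def p s_def numeral_2_eq_2 algebra_simps)
  qed
  moreover have "s powr \<alpha> * (I 2 [x / s, y / s] - (c * entropy_deg \<alpha> 2 [x / s, y / s] + h (x / s)))
    = s powr \<alpha> * I 2 [x / s, y / s] - c * (s powr \<alpha> * entropy_deg \<alpha> 2 [x / s, y / s])
      - s powr \<alpha> * h (x / s)"
    by (simp add: algebra_simps)
  moreover have "c * entropy_deg \<alpha> (Suc n) p
    = c * entropy_deg \<alpha> n (s # ps) + c * (s powr \<alpha> * entropy_deg \<alpha> 2 [x / s, y / s])"
    by (simp add: ent algebra_simps)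
  ultimately have "\<bar>I (Suc n) p - (c * entropy_deg \<alpha> (Suc n) p + h x)\<bar>
      \<le> (\<Sum>k=2..n. \<epsilon> k) + B * (1 + (\<Sum>k=2..n. psum p k powr \<alpha>))"
    using h_x by linarith
  then show ?case by (simp add: p psum_def)
qed

section \<open>Estimates of the accumulated weights and of \<open>K_const\<close>\<close>

lemma partial_sums_bound_nonneg:
  assumes "0 \<le> \<alpha>" "2 \<le> n" "p \<in> open_simplex n"
  shows "1 + (\<Sum>k=2..n-1. (\<Sum>i<k. p ! i) powr \<alpha>) \<le> real n - 1"
proof -
  have "(\<Sum>i<k. p ! i) powr \<alpha> \<le> 1" if "k \<in> {2..n-1}" for k
  proof -
    have nonneg: "0 \<le> p ! i" if "i < n" for i
      using assms(3) that by (force simp: open_simplex_def)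
    have "(\<Sum>i<k. p ! i) \<le> (\<Sum>i<n. p ! i)"
      using that by (intro sum_mono2) (auto intro!: nonneg)
    moreover have "0 \<le> (\<Sum>i<k. p ! i)"
      using that by (intro sum_nonneg) (auto intro!: nonneg)
    ultimately show ?thesis
      using assms powr_mono2[of \<alpha> "\<Sum>i<k. p ! i" 1] by (simp add: open_simplex_def)
  qed
  then have "(\<Sum>k=2..n-1. (\<Sum>i<k. p ! i) powr \<alpha>) \<le> (\<Sum>k=2..n-1. 1)"
    by (rule sum_mono)
  then show ?thesis using assms(2) by (simp add: of_nat_diff)
qed

text \<open>For nonpositive degree the power is decreasing, so that of a partial sum is at most that
  of its first coordinate, itself a summand on the right.\<close>

lemma partial_sums_bound_nonpos:
  assumes "\<alpha> \<le> 0" "p \<in> open_simplex n"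
  shows "1 + (\<Sum>k=2..n-1. (\<Sum>i<k. p ! i) powr \<alpha>)
    \<le> 1 + (\<Sum>k=2..n-1. \<Sum>i<k. (p ! i) powr \<alpha>)"
proof (intro add_left_mono sum_mono)
  fix k assume k: "k \<in> {2..n-1}"
  have pos: "0 < p ! i" if "i < n" for i
    using assms(2) that by (simp add: open_simplex_def)
  have "p ! 0 \<le> (\<Sum>i<k. p ! i)"
    using k by (intro member_le_sum) (auto intro!: less_imp_le[OF pos])
  then have "(\<Sum>i<k. p ! i) powr \<alpha> \<le> (p ! 0) powr \<alpha>"
    using k assms(1) pos[of 0] by (intro powr_mono2') auto
  also have "\<dots> \<le> (\<Sum>i<k. (p ! i) powr \<alpha>)"
    using k by (intro member_le_sum) auto
  finally show "(\<Sum>i<k. p ! i) powr \<alpha> \<le> (\<Sum>i<k. (p ! i) powr \<alpha>)" .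
qed

lemma K_const_nonneg: "0 \<le> K_const \<alpha>"
  by (simp add: K_const_def)

text \<open>The factorization \<open>2 - r = r * (2 powr (1 - \<alpha>) - 1)\<close> produces the
  denominators of \<open>K_const\<close>. As \<open>1 \<le> r \<le> 3 powr \<alpha>\<close> and 2 *
  (7 + 9) = 32, the last summand of \<open>K_const\<close> alone absorbs the bound.\<close>

lemma K_const_bound:
  assumes "0 < \<alpha>" "\<alpha> \<noteq> 1" "0 \<le> e"
  shows "2 * (e * (7 * 2 powr \<alpha> + 9 * 3 powr \<alpha>) / \<bar>2 - 2 powr \<alpha>\<bar>) / \<bar>2 powr (- \<alpha>) - 1\<bar>
    \<le> K_const \<alpha> * e"
proof -
  define r d g where "r = (2::real) powr \<alpha>" and "d = \<bar>2 powr (1 - \<alpha>) - (1::real)\<bar>"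
    and "g = \<bar>2 powr (- \<alpha>) - (1::real)\<bar>"
  have r: "1 \<le> r" "r \<le> 3 powr \<alpha>"
    using assms by (auto simp: r_def intro: ge_one_powr_ge_zero powr_mono2)
  have "2 - r = r * (2 powr (1 - \<alpha>) - 1)"
    by (simp add: r_def powr_diff algebra_simps)
  then have d: "\<bar>2 - r\<bar> = r * d"
    using r by (simp add: d_def abs_mult)
  have "2 * (7 * r + 9 * 3 powr \<alpha>) \<le> 32 * 3 powr \<alpha>"
    using r by simp
  also have "\<dots> \<le> 96 * 3 powr \<alpha> * r"
    using r mult_left_mono[of 1 r "96 * 3 powr \<alpha>"] by simp
  finally have "2 * (7 * r + 9 * 3 powr \<alpha>) / r \<le> 32 * 3 powr (\<alpha> + 1)"
    using r by (simp add: pos_divide_le_eq powr_add)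
  then have "inverse d * (2 * (7 * r + 9 * 3 powr \<alpha>) / r / g) * e
      \<le> inverse d * (3 + 12 * r + 32 * 3 powr (\<alpha> + 1) / g) * e"
    using r assms(3)
    by (intro mult_right_mono mult_left_mono add_increasing divide_right_mono)
      (auto simp: d_def g_def)
  moreover have "inverse d * (2 * (7 * r + 9 * 3 powr \<alpha>) / r / g) * e
      = 2 * (e * (7 * r + 9 * 3 powr \<alpha>) / \<bar>2 - r\<bar>) / g"
    by (simp add: d field_simps)
  moreover have "K_const \<alpha> = inverse d * (3 + 12 * r + 32 * 3 powr (\<alpha> + 1) / g)"
    using assms by (simp add: K_const_def r_def d_def g_def)
  ultimately show ?thesis
    by (simp add: r_def g_def)
qed

section \<open>The binary information function as an approximate cocycle\<close>

text \<open>After normalizing \<open>u, y, z\<close> to total mass 1, recursivity for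
  \<open>n = 3\<close> is used for both orders of \<open>y, z\<close> and semisymmetry once between
  them: hence \<open>2 * \<epsilon> 2 + \<epsilon> 1\<close>.\<close>

lemma binary_approx_information:
  fixes I :: "nat \<Rightarrow> real list \<Rightarrow> real"
  assumes eps_nonneg: "\<And>n. n \<ge> 1 \<Longrightarrow> 0 \<le> \<epsilon> n"
    and recursivity: "\<And>n p1 p2 ps. n \<ge> 3 \<Longrightarrow> p1 # p2 # ps \<in> open_simplex n \<Longrightarrow>
      \<bar>I n (p1 # p2 # ps) - I (n - 1) ((p1 + p2) # ps)
        - (p1 + p2) powr \<alpha> * I 2 [p1 / (p1 + p2), p2 / (p1 + p2)]\<bar> \<le> \<epsilon> (n - 1)"
    and semisymmetry: "\<And>p1 p2 p3. [p1, p2, p3] \<in> open_simplex 3 \<Longrightarrow>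
      \<bar>I 3 [p1, p2, p3] - I 3 [p1, p3, p2]\<bar> \<le> \<epsilon> 1"
  shows "approx_information (\<lambda>u v. (u + v) powr \<alpha> * I 2 [u / (u + v), v / (u + v)]) \<alpha>
    (2 * \<epsilon> 2 + \<epsilon> 1)"
proof
  show "0 \<le> 2 * \<epsilon> 2 + \<epsilon> 1" using eps_nonneg[of 1] eps_nonneg[of 2] by simp
next
  fix t u v :: real
  assume "0 < t" "0 < u" "0 < v"
  then show "(t * u + t * v) powr \<alpha> * I 2 [t * u / (t * u + t * v), t * v / (t * u + t * v)]
      = t powr \<alpha> * ((u + v) powr \<alpha> * I 2 [u / (u + v), v / (u + v)])"
    by (simp add: powr_mult flip: distrib_left)
next
  fix u y z :: real
  assume pos: "0 < u" "0 < y" "0 < z"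
  define s where "s = u + y + z"
  have s: "0 < s" using pos by (simp add: s_def)
  define D where "D y z = I 3 [u / s, y / s, z / s] - I 2 [(u + y) / s, z / s]
    - ((u + y) / s) powr \<alpha> * I 2 [u / (u + y), y / (u + y)]" for y z
  have simplex: "[u / s, y / s, z / s] \<in> open_simplex 3"
    if "0 < y" "0 < z" "u + y + z = s" for y z
    using that pos s
    by (auto simp: open_simplex_def less_Suc_eq eval_nat_numeral simp flip: add_divide_distrib)
  have D: "\<bar>D y z\<bar> \<le> \<epsilon> 2" if "0 < y" "0 < z" "u + y + z = s" for y z
    using recursivity[of 3 "u / s" "y / s" "[z / s]"] simplex[OF that] s
    by (simp add: D_def flip: add_divide_distrib)
  have "(u + y + z) powr \<alpha> * I 2 [(u + y) / (u + y + z), z / (u + y + z)]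
      + (u + y) powr \<alpha> * I 2 [u / (u + y), y / (u + y)]
    - (u + z + y) powr \<alpha> * I 2 [(u + z) / (u + z + y), y / (u + z + y)]
      - (u + z) powr \<alpha> * I 2 [u / (u + z), z / (u + z)]
    = s powr \<alpha> * (I 3 [u / s, y / s, z / s] - I 3 [u / s, z / s, y / s] - D y z + D z y)"
  proof -
    have cancel: "s powr \<alpha> * (((u + w) / s) powr \<alpha> * v) = (u + w) powr \<alpha> * v" if "0 < w" for v w
      using s pos that by (simp add: powr_divide)
    have eqs: "u + y + z = s" "u + z + y = s" by (simp_all add: s_def)
    show ?thesis
      unfolding eqs D_def by (simp only: right_diff_distrib distrib_left cancel pos)
  qed
  moreover have "\<bar>I 3 [u / s, y / s, z / s] - I 3 [u / s, z / s, y / s] - D y z + D z y\<bar>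
      \<le> 2 * \<epsilon> 2 + \<epsilon> 1"
    using semisymmetry[OF simplex[OF pos(2,3)]] D[OF pos(2,3)] D[OF pos(3,2)]
    by (simp add: s_def)
  ultimately show "\<bar>(u + y + z) powr \<alpha> * I 2 [(u + y) / (u + y + z), z / (u + y + z)]
      + (u + y) powr \<alpha> * I 2 [u / (u + y), y / (u + y)]
    - (u + z + y) powr \<alpha> * I 2 [(u + z) / (u + z + y), y / (u + z + y)]
      - (u + z) powr \<alpha> * I 2 [u / (u + z), z / (u + z)]\<bar>
    \<le> (2 * \<epsilon> 2 + \<epsilon> 1) * (u + y + z) powr \<alpha>"
    by (simp add: abs_mult mult_left_mono mult.commute[of _ "s powr \<alpha>"] flip: s_def)
qed

section \<open>Assembly of the three ranges of \<open>\<alpha>\<close>\<close>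

theorem theorem4p2:
  fixes I :: "nat \<Rightarrow> real list \<Rightarrow> real"
    and \<epsilon> :: "nat \<Rightarrow> real"
    and \<alpha> :: real
  assumes eps_nonneg: "\<And>n. n \<ge> 1 \<Longrightarrow> 0 \<le> \<epsilon> n"
    and alpha_ne_1: "\<alpha> \<noteq> 1"
    and recursivity: "\<And>n p1 p2 ps. n \<ge> 3 \<Longrightarrow> p1 # p2 # ps \<in> open_simplex n \<Longrightarrow>
      \<bar>I n (p1 # p2 # ps) - I (n - 1) ((p1 + p2) # ps)
        - (p1 + p2) powr \<alpha> * I 2 [p1 / (p1 + p2), p2 / (p1 + p2)]\<bar> \<le> \<epsilon> (n - 1)"
    and semisymmetry: "\<And>p1 p2 p3. [p1, p2, p3] \<in> open_simplex 3 \<Longrightarrow>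
      \<bar>I 3 [p1, p2, p3] - I 3 [p1, p3, p2]\<bar> \<le> \<epsilon> 1"
  shows
    "(\<alpha> < 0 \<longrightarrow>
       (\<exists>c d. \<forall>n\<ge>2. \<forall>p\<in>open_simplex n.
          \<bar>I n p - (c * entropy_deg \<alpha> n p + d * ((p ! 0) powr \<alpha> - 1))\<bar>
            \<le> (\<Sum>k=2..n-1. \<epsilon> k)
               + K_const \<alpha> * (2 * \<epsilon> 2 + \<epsilon> 1)
                   * (1 + (\<Sum>k=2..n-1. \<Sum>i<k. (p ! i) powr \<alpha>)))) \<and>
     (\<alpha> = 0 \<longrightarrow>
       (\<exists>l c. logarithmic l \<and> (\<forall>n\<ge>2. \<forall>p\<in>open_simplex n.
          \<bar>I n p - (c * entropy_deg 0 n p + l (p ! 0))\<bar>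
            \<le> (\<Sum>k=2..n-1. \<epsilon> k)
               + K_const \<alpha> * (real n - 1) * (2 * \<epsilon> 2 + \<epsilon> 1)))) \<and>
     (\<alpha> > 0 \<longrightarrow>
       (\<exists>c d. \<forall>n\<ge>2. \<forall>p\<in>open_simplex n.
          \<bar>I n p - (c * entropy_deg \<alpha> n p + d * ((p ! 0) powr \<alpha> - 1))\<bar>
            \<le> (\<Sum>k=2..n-1. \<epsilon> k)
               + (real n - 1) * K_const \<alpha> * (2 * \<epsilon> 2 + \<epsilon> 1)))"
proof -
  define G where "G u v = (u + v) powr \<alpha> * I 2 [u / (u + v), v / (u + v)]" for u v
  define e where "e = 2 * \<epsilon> 2 + \<epsilon> 1"
  interpret approx_information G \<alpha> e
    unfolding G_def e_def using eps_nonneg recursivity semisymmetry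
    by (rule binary_approx_information)
  have G1: "G x (1 - x) = I 2 [x, 1 - x]" for x
    by (simp add: G_def)
  have unit: "2 powr (1 - \<alpha>) - 1 \<noteq> 0"
    using alpha_ne_1 powr_inj[of 2 "1 - \<alpha>" 0] by auto
  have power: "\<exists>c d. \<forall>x. 0 < x \<longrightarrow> x < 1 \<longrightarrow>
      \<bar>I 2 [x, 1 - x] - (c * entropy_deg \<alpha> 2 [x, 1 - x] + d * (x powr \<alpha> - 1))\<bar> \<le> K_const \<alpha> * e"
    if nonzero: "\<alpha> \<noteq> 0"
  proof -
    obtain a b where ab: "\<And>x. \<lbrakk>0 < x; x < 1\<rbrakk> \<Longrightarrow>
      \<bar>I 2 [x, 1 - x] - (a * (1 - x) powr \<alpha> + b * (x powr \<alpha> - 1))\<bar> \<le> K_const \<alpha> * e"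
    proof (cases "\<alpha> < 0")
      case True
      \<comment> \<open>For negative degree the binary representation is exact; its error 0 is then
        raised to the nonnegative \<open>K_const \<alpha> * e\<close>.\<close>
      then interpret exact: approx_information G \<alpha> 0 by (rule exact_if_neg)
      obtain a b where bound: "\<forall>x\<in>{0<..<1}.
          \<bar>G x (1 - x) - (a * (1 - x) powr \<alpha> + b * (x powr \<alpha> - 1))\<bar> \<le> 0"
        using exact.power_stability[OF _ alpha_ne_1 nonzero] by auto
      have "0 \<le> K_const \<alpha> * e"
        using K_const_nonneg e_nonneg by simp
      then show thesis
        using bound unfolding G1 by (intro that[of a b]) (force intro: order_trans)
    next
      case False
      then have pos: "0 < \<alpha>" using nonzero by simp
      obtain a b where bound: "\<forall>x\<in>{0<..<1}.
          \<bar>G x (1 - x) - (a * (1 - x) powr \<alpha> + b * (x powr \<alpha> - 1))\<bar>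
          \<le> 2 * (e * (7 * 2 powr \<alpha> + 9 * 3 powr \<alpha>) / \<bar>2 - 2 powr \<alpha>\<bar>) / \<bar>2 powr (- \<alpha>) - 1\<bar>"
        using power_stability[OF disjI1[OF less_imp_le[OF pos]] alpha_ne_1 nonzero] by (elim exE)
      show thesis
      proof (rule that[of a b])
        fix x :: real
        assume "0 < x" "x < 1"
        then show "\<bar>I 2 [x, 1 - x] - (a * (1 - x) powr \<alpha> + b * (x powr \<alpha> - 1))\<bar> \<le> K_const \<alpha> * e"
          using order_trans[OF bspec[OF bound] K_const_bound[OF pos alpha_ne_1 e_nonneg], of x]
          unfolding G1 by (simp only: greaterThanLessThan_iff simp_thms)
      qed
    qed
    \<comment> \<open>Undoes the normalizing factor of the entropy:
      \<open>a * (x powr \<alpha> + (1 - x) powr \<alpha> - 1)\<close> becomes the entropy term, and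
      \<open>b - a\<close> remains as coefficient of \<open>x powr \<alpha> - 1\<close>.\<close>
    define c where "c = a * (2 powr (1 - \<alpha>) - 1)"
    have c: "a = c * inverse (2 powr (1 - \<alpha>) - 1)"
      using unit by (simp add: c_def)
    have "a * (1 - x) powr \<alpha> + b * (x powr \<alpha> - 1)
        = c * entropy_deg \<alpha> 2 [x, 1 - x] + (b - a) * (x powr \<alpha> - 1)" for x
      unfolding entropy_deg_binary mult.assoc[symmetric] c[symmetric] by (simp add: algebra_simps)
    then show ?thesis using ab by (intro exI[of _ c] exI[of _ "b - a"]) auto
  qed
  have logarithm: "\<exists>l c. logarithmic l \<and> (\<forall>x. 0 < x \<longrightarrow> x < 1 \<longrightarrow>
      \<bar>I 2 [x, 1 - x] - (c * entropy_deg \<alpha> 2 [x, 1 - x] + l x)\<bar> \<le> K_const \<alpha> * e)"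
    if zero: "\<alpha> = 0"
  proof -
    \<comment> \<open>At degree 0 all powers of positive bases are 1, so the general constant
      becomes (7 + 9) / 1 = 16.\<close>
    obtain a where a: "\<And>s t. \<lbrakk>0 < s; s < 1; 0 < t; t < 1\<rbrakk> \<Longrightarrow>
        \<bar>(G (t * s) (1 - t * s) - a) - (G t (1 - t) - a) - (G s (1 - s) - a)\<bar> \<le> 16 * e"
    proof -
      obtain a where a: "\<forall>s\<in>{0<..<1}. \<forall>t\<in>{0<..<1}.
          \<bar>(G (t * s) (1 - t * s) - a * (1 - t * s) powr \<alpha>)
            - (G t (1 - t) - a * (1 - t) powr \<alpha>)
            - t powr \<alpha> * (G s (1 - s) - a * (1 - s) powr \<alpha>)\<bar>
          \<le> e * (7 * 2 powr \<alpha> + 9 * 3 powr \<alpha>) / \<bar>2 - 2 powr \<alpha>\<bar>"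
        using power_approx_multiplicative[OF disjI1[OF eq_refl[OF zero[symmetric]]] alpha_ne_1]
        by (elim exE)
      show thesis
      proof (rule that[of a])
        fix s t :: real
        assume st: "0 < s" "s < 1" "0 < t" "t < 1"
        \<comment> \<open>Excludes the default value \<open>0 powr 0 = 0\<close>, so that
          \<open>(1 - t * s) powr 0 = 1\<close>.\<close>
        then have "t * s \<noteq> 1" using mult_strict_mono[of t 1 s 1] by auto
        then show "\<bar>(G (t * s) (1 - t * s) - a) - (G t (1 - t) - a) - (G s (1 - s) - a)\<bar> \<le> 16 * e"
          using bspec[OF bspec[OF a, of s], of t] st by (simp add: zero)
      qed
    qed
    obtain l where l: "logarithmic l" "\<forall>t\<in>{0<..<1}. \<bar>(G t (1 - t) - a) - l t\<bar> \<le> 16 * e"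
      using logarithmic_stability[of "\<lambda>t. G t (1 - t) - a" "16 * e"] a by blast
    \<comment> \<open>The binary entropy of degree 0 is constantly 1, which turns the constant
      \<open>a\<close> into an entropy term; and 16 \<le> 63.\<close>
    have "\<bar>I 2 [x, 1 - x] - (a * entropy_deg \<alpha> 2 [x, 1 - x] + l x)\<bar> \<le> K_const \<alpha> * e"
      if "0 < x" "x < 1" for x
      using bspec[OF l(2), of x] that e_nonneg G1[of x]
      by (simp add: entropy_deg_binary zero K_const_def algebra_simps)
    with l(1) show ?thesis by blast
  qed
  \<comment> \<open>\<open>C\<close> stands for the bound on the accumulated weights:
    \<open>real n - 1\<close> for \<open>\<alpha> \<ge> 0\<close>, the sums of coordinate powers for
    \<open>\<alpha> < 0\<close>.\<close>
  have error: "\<bar>I n p - (c * entropy_deg \<alpha> n p + h (p ! 0))\<bar>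
      \<le> (\<Sum>k=2..n-1. \<epsilon> k) + K_const \<alpha> * e * C"
    if "\<And>x. 0 < x \<longrightarrow> x < 1 \<longrightarrow>
        \<bar>I 2 [x, 1 - x] - (c * entropy_deg \<alpha> 2 [x, 1 - x] + h x)\<bar> \<le> K_const \<alpha> * e"
      and "\<And>x s. \<lbrakk>0 < x; x < s; s < 1\<rbrakk> \<Longrightarrow> h x = h s + s powr \<alpha> * h (x / s)"
      and "2 \<le> n" "p \<in> open_simplex n"
      and "1 + (\<Sum>k=2..n-1. (\<Sum>i<k. p ! i) powr \<alpha>) \<le> C"
    for n p c h C
  proof -
    have "\<bar>I n p - (c * entropy_deg \<alpha> n p + h (p ! 0))\<bar>
        \<le> (\<Sum>k=2..n-1. \<epsilon> k)
          + K_const \<alpha> * e * (1 + (\<Sum>k=2..n-1. (\<Sum>i<k. p ! i) powr \<alpha>))"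
      using that by (intro recursive_error recursivity) auto
    moreover have "K_const \<alpha> * e * (1 + (\<Sum>k=2..n-1. (\<Sum>i<k. p ! i) powr \<alpha>))
        \<le> K_const \<alpha> * e * C"
      using that(5) K_const_nonneg e_nonneg by (intro mult_left_mono) auto
    ultimately show ?thesis by linarith
  qed
  \<comment> \<open>This and \<open>log_law\<close> supply the exact equation for \<open>h\<close>
    on which the induction over \<open>n\<close> rests.\<close>
  have power_law: "d * (x powr \<alpha> - 1)
      = d * (s powr \<alpha> - 1) + s powr \<alpha> * (d * ((x / s) powr \<alpha> - 1))"
    if "0 < x" "x < s" "s < 1" for d x s :: real
  proof -
    have "s powr \<alpha> * (x / s) powr \<alpha> = x powr \<alpha>"
      using that by (simp add: powr_divide)
    then show ?thesis by (simp add: right_diff_distrib mult.left_commute[of _ d])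
  qed
  have log_law: "l x = l s + s powr \<alpha> * l (x / s)"
    if "\<alpha> = 0" "logarithmic l" "0 < x" "x < s" "s < 1" for l x s
  proof -
    have "l (s * (x / s)) = l s + l (x / s)"
      using that unfolding logarithmic_def by (metis divide_less_eq_1_pos divide_pos_pos
          greaterThanLessThan_iff order_less_trans)
    then show ?thesis using that by simp
  qed
  show ?thesis
    unfolding e_def[symmetric]
  proof (intro conjI impI)
    assume neg: "\<alpha> < 0"
    then obtain c d where cd: "\<And>x. 0 < x \<longrightarrow> x < 1 \<longrightarrow>
      \<bar>I 2 [x, 1 - x] - (c * entropy_deg \<alpha> 2 [x, 1 - x] + d * (x powr \<alpha> - 1))\<bar> \<le> K_const \<alpha> * e"
      using power by force
    show "\<exists>c d. \<forall>n\<ge>2. \<forall>p\<in>open_simplex n.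
        \<bar>I n p - (c * entropy_deg \<alpha> n p + d * ((p ! 0) powr \<alpha> - 1))\<bar>
          \<le> (\<Sum>k=2..n-1. \<epsilon> k)
            + K_const \<alpha> * e * (1 + (\<Sum>k=2..n-1. \<Sum>i<k. (p ! i) powr \<alpha>))"
      by (intro exI[of _ c] exI[of _ d] allI ballI impI
          error[where h = "\<lambda>x. d * (x powr \<alpha> - 1)", OF cd power_law]
          partial_sums_bound_nonpos less_imp_le[OF neg])
  next
    assume zero: "\<alpha> = 0"
    then obtain l c where l: "logarithmic l" and lc: "\<And>x. 0 < x \<longrightarrow> x < 1 \<longrightarrow>
        \<bar>I 2 [x, 1 - x] - (c * entropy_deg \<alpha> 2 [x, 1 - x] + l x)\<bar> \<le> K_const \<alpha> * e"
      using logarithm by blast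
    have "\<bar>I n p - (c * entropy_deg 0 n p + l (p ! 0))\<bar>
        \<le> (\<Sum>k=2..n-1. \<epsilon> k) + K_const \<alpha> * (real n - 1) * e"
      if "2 \<le> n" "p \<in> open_simplex n" for n p
      using error[of c l, OF lc log_law[OF zero l] that partial_sums_bound_nonneg[OF _ that]] zero
      by (simp add: mult_ac)
    with l show "\<exists>l c. logarithmic l \<and> (\<forall>n\<ge>2. \<forall>p\<in>open_simplex n.
        \<bar>I n p - (c * entropy_deg 0 n p + l (p ! 0))\<bar>
          \<le> (\<Sum>k=2..n-1. \<epsilon> k) + K_const \<alpha> * (real n - 1) * e)"
      by blast
  next
    assume pos: "0 < \<alpha>"
    then obtain c d where cd: "\<And>x. 0 < x \<longrightarrow> x < 1 \<longrightarrow>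
      \<bar>I 2 [x, 1 - x] - (c * entropy_deg \<alpha> 2 [x, 1 - x] + d * (x powr \<alpha> - 1))\<bar> \<le> K_const \<alpha> * e"
      using power by force
    have "\<bar>I n p - (c * entropy_deg \<alpha> n p + d * ((p ! 0) powr \<alpha> - 1))\<bar>
        \<le> (\<Sum>k=2..n-1. \<epsilon> k) + (real n - 1) * K_const \<alpha> * e"
      if "2 \<le> n" "p \<in> open_simplex n" for n p
      using error[where h = "\<lambda>x. d * (x powr \<alpha> - 1)",
          OF cd power_law that partial_sums_bound_nonneg[OF less_imp_le[OF pos] that]]
      by (simp add: mult_ac)
    then show "\<exists>c d. \<forall>n\<ge>2. \<forall>p\<in>open_simplex n.
        \<bar>I n p - (c * entropy_deg \<alpha> n p + d * ((p ! 0) powr \<alpha> - 1))\<bar>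
          \<le> (\<Sum>k=2..n-1. \<epsilon> k) + (real n - 1) * K_const \<alpha> * e"
      by blast
  qed
qed

end
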